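(* Let $\varphi(z)=\frac{1}{\sqrt{2\pi}}e^{-z^2/2}$, $\Psi(z)=\int_z^\infty\varphi(w)\,dw$ for $z\in\mathbb{C}$, $R:=\varphi/\Psi$, and $H_+=\{z\in\mathbb{C}:\Re z\ge 0\}$. For any natural number $n\ge1$ and any $z\in H_+$ with $x:=\Re z>0$, the $n$th derivative of $R$ satisfies $$\big|R^{(n)}(z)\big|\le \frac{n!}{x^n}\,\sqrt{\big|z+\sqrt{2/\pi}\big|^2+x^2}.$$ Moreover, for each natural number $n\ge1$, $$\frac{\big|R^{(n)}(z)-\mathrm{I}\{n=1\}\big|}{|z|/x^n}\longrightarrow 0\qquad\text{as } z\in H_+ \text{ and } x=\Re z\to\infty,$$ where $\mathrm{I}\{n=1\}$ equals $1$ if $n=1$ and $0$ otherwise.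
   Context: $\Psi$ is an entire function: the integral $\int_z^\infty\varphi(w)\,dw$ is taken along any path from $z$ to the point $\infty=\infty+0i$ of the extended real axis; equivalently $\Psi(z)=\frac12\operatorname{erfc}(z/\sqrt2)$. It has no zeros in $H_+$, so that $R$ (the inverse Mills ratio) is well defined on $H_+$ and holomorphic on its interior. The limit as $x=\Re z\to\infty$ is uniform in $\Im z$: for every $\varepsilon>0$ there is $x_0$ such that the ratio is less than $\varepsilon$ for all $z$ with $\Re z\ge x_0$. *)

theory Defs
  imports "HOL-Complex_Analysis.Complex_Analysis"
begin

definition phi :: "complex \<Rightarrow> complex" where
  "phi z = exp (- (z\<^sup>2) / 2) / of_real (sqrt (2 * pi))"

(* The integral of phi from z to the point \<infinity> + 0i. The segments from z to real points r
   are merely one choice of path: Psi_limit_any_path shows that the limit exists and that any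
   other choice gives the same value. *)
definition Psi :: "complex \<Rightarrow> complex" where
  "Psi z = Lim at_top (\<lambda>r::real. contour_integral (linepath z (of_real r)) phi)"

(* The inverse Mills ratio. HOL's convention x / 0 = 0 makes it total; Psi has no zeros
   in Hplus. *)
definition R :: "complex \<Rightarrow> complex" where
  "R z = phi z / Psi z"

definition Hplus :: "complex set" where
  "Hplus = {z. 0 \<le> Re z}"

lemma norm_phi_le: "norm (phi z) \<le> exp (((Im z)\<^sup>2 - (Re z)\<^sup>2) / 2)"
proof -
  have "1 \<le> 2 * pi" using pi_gt3 by linarith
  hence s: "1 \<le> sqrt (2 * pi)" by simp
  have "norm (phi z) = exp (((Im z)\<^sup>2 - (Re z)\<^sup>2) / 2) / sqrt (2 * pi)"
    by (simp add: phi_def norm_divide norm_exp_eq_Re Re_power2 field_simps real_sqrt_mult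
      norm_mult)
  also have "\<dots> \<le> exp (((Im z)\<^sup>2 - (Re z)\<^sup>2) / 2) / 1"
    by (intro divide_left_mono) (use s in auto)
  finally show ?thesis by simp
qed

lemma phi_primitive_ex:
  "\<exists>F L. (\<forall>z. (F has_field_derivative phi z) (at z)) \<and>
     (\<forall>z. 2 \<le> Re z \<longrightarrow> \<bar>Im z\<bar> \<le> 1 \<longrightarrow>
        norm (F z - L) \<le> exp (- Re z) + exp (1/2) * \<bar>Im z\<bar>)"
proof -
  have hol: "phi holomorphic_on UNIV"
    unfolding phi_def by (intro holomorphic_intros) auto
  obtain F where F: "\<And>z. (F has_field_derivative phi z) (at z)"
    using holomorphic_convex_primitive'[of UNIV phi] hol by auto
  have Fr: "((\<lambda>x. F (of_real x)) has_vector_derivative phi (of_real x)) (at x)" for x :: real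
    using F[of "of_real x"]
    by (rule has_vector_derivative_real_field)
  have bnd: "norm (F (of_real b) - F (of_real a)) \<le> exp (- a)" if "2 \<le> a" "a < b" for a b :: real
  proof -
    have "norm (F (of_real b) - F (of_real a)) \<le> - exp (- b) - (- exp (- a))"
    proof (rule differentiable_bound_general[where f' = "\<lambda>x. phi (of_real x)"
          and \<phi>' = "\<lambda>x. exp (- x)"])
      show "continuous_on {a..b} (\<lambda>x. F (of_real x))"
        by (intro continuous_at_imp_continuous_on ballI
            has_vector_derivative_continuous[OF Fr])
      show "continuous_on {a..b} (\<lambda>x. - exp (- x))" by (intro continuous_intros)
      show "((\<lambda>x. - exp (- x)) has_vector_derivative exp (- x)) (at x)" for x :: real
        unfolding has_real_derivative_iff_has_vector_derivative[symmetric]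
        by (auto intro!: derivative_eq_intros)
      fix x assume x: "a < x" "x < b"
      have "2 * x \<le> x * x" using x that by (intro mult_right_mono) auto
      hence "- (x\<^sup>2) / 2 \<le> - x" by (simp add: power2_eq_square)
      thus "norm (phi (of_real x)) \<le> exp (- x)"
        using norm_phi_le[of "of_real x"] by (simp add: order_trans)
    qed (use that Fr in auto)
    thus ?thesis using exp_gt_zero[of "-b"] by linarith
  qed
  have "Cauchy (\<lambda>n. F (of_real (real n)))"
  proof (rule metric_CauchyI)
    fix e :: real assume e: "0 < e"
    have "(\<lambda>n. exp (- real n)) \<longlonglongrightarrow> 0" by real_asymp
    hence "eventually (\<lambda>n. exp (- real n) < e) sequentially"
      using e by (rule order_tendstoD)
    then obtain N where N: "\<And>n. N \<le> n \<Longrightarrow> exp (- real n) < e"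
      by (auto simp: eventually_sequentially)
    show "\<exists>M. \<forall>m\<ge>M. \<forall>n\<ge>M. dist (F (of_real (real m))) (F (of_real (real n))) < e"
    proof (intro exI allI impI)
      fix m n assume mn: "max N 2 \<le> m" "max N 2 \<le> n"
      consider "m < n" | "m = n" | "n < m" by linarith
      thus "dist (F (of_real (real m))) (F (of_real (real n))) < e"
      proof cases
        case 1 thus ?thesis using bnd[of m n] N[of m] mn by (simp add: dist_norm norm_minus_commute)
      next
        case 3 thus ?thesis using bnd[of n m] N[of n] mn by (simp add: dist_norm)
      qed (use e in auto)
    qed
  qed
  then obtain L where L: "(\<lambda>n. F (of_real (real n))) \<longlonglongrightarrow> L"
    using Cauchy_convergent convergent_def by blast
  have 1: "norm (L - F (of_real a)) \<le> exp (- a)" if "2 \<le> a" for a :: real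
  proof (rule Lim_norm_ubound[OF trivial_limit_sequentially])
    show "(\<lambda>n. F (of_real (real n)) - F (of_real a)) \<longlonglongrightarrow> L - F (of_real a)"
      by (intro tendsto_intros L)
    show "\<forall>\<^sub>F n in sequentially. norm (F (of_real (real n)) - F (of_real a)) \<le> exp (- a)"
      using eventually_gt_at_top[of "nat \<lceil>a\<rceil>"]
    proof eventually_elim
      case (elim n)
      hence "a < real n" by linarith
      thus ?case using bnd that by blast
    qed
  qed
  have 2: "norm (F z - F (of_real (Re z))) \<le> exp (1/2) * \<bar>Im z\<bar>" if "\<bar>Im z\<bar> \<le> 1" for z
  proof -
    have "(phi has_contour_integral F z - F (of_real (Re z))) (linepath (of_real (Re z)) z)"
      using contour_integral_primitive[of UNIV F phi "linepath (of_real (Re z)) z"] F by simp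
    hence "norm (F z - F (of_real (Re z))) \<le> exp (1/2) * norm (z - of_real (Re z))"
    proof (rule has_contour_integral_bound_linepath)
      fix w assume "w \<in> closed_segment (of_real (Re z)) z"
      then obtain u where u: "0 \<le> u" "u \<le> 1" "w = (1 - u) *\<^sub>R of_real (Re z) + u *\<^sub>R z"
        by (auto simp: closed_segment_def)
      have "\<bar>Im w\<bar> \<le> 1" using u that mult_mono[of u 1 "\<bar>Im z\<bar>" 1] by (simp add: abs_mult)
      hence "(Im w)\<^sup>2 \<le> 1" by (simp add: abs_square_le_1)
      hence "((Im w)\<^sup>2 - (Re w)\<^sup>2) / 2 \<le> 1/2"
        using diff_mono[OF _ zero_le_power2, of "(Im w)\<^sup>2" 1 "Re w"]
        by (intro divide_right_mono) (simp_all only: diff_zero zero_le_numeral)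
      thus "norm (phi w) \<le> exp (1/2)" using norm_phi_le[of w] by (meson exp_le_cancel_iff order_trans)
    qed auto
    also have "norm (z - of_real (Re z)) = \<bar>Im z\<bar>" by (simp add: cmod_def)
    finally show ?thesis .
  qed
  have "norm (F z - L) \<le> exp (- Re z) + exp (1/2) * \<bar>Im z\<bar>"
    if "2 \<le> Re z" "\<bar>Im z\<bar> \<le> 1" for z
    using 1[OF that(1)] 2[OF that(2)] norm_triangle_ineq[of "F z - F (of_real (Re z))" "F (of_real (Re z)) - L"]
    by (simp add: norm_minus_commute)
  with F show ?thesis by blast
qed

lemma Psi_limit_any_path:
  assumes "\<And>t. valid_path (g t)" "\<And>t. pathstart (g t) = z"
    and "filterlim (\<lambda>t. Re (pathfinish (g t))) at_top \<F>"
    and "((\<lambda>t. Im (pathfinish (g t))) \<longlongrightarrow> 0) \<F>"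
  shows "((\<lambda>t. contour_integral (g t) phi) \<longlongrightarrow> Psi z) \<F>"
proof -
  obtain F L where F: "\<And>z. (F has_field_derivative phi z) (at z)"
    and L: "\<And>z. 2 \<le> Re z \<Longrightarrow> \<bar>Im z\<bar> \<le> 1 \<Longrightarrow>
        norm (F z - L) \<le> exp (- Re z) + exp (1/2) * \<bar>Im z\<bar>"
    using phi_primitive_ex by blast
  have lim: "((\<lambda>t. contour_integral (h t) phi) \<longlongrightarrow> L - F z) G"
    if h: "\<And>t. valid_path (h t)" "\<And>t. pathstart (h t) = z"
      and re: "filterlim (\<lambda>t. Re (pathfinish (h t))) at_top G"
      and im: "((\<lambda>t. Im (pathfinish (h t))) \<longlongrightarrow> 0) G"
    for h :: "'b \<Rightarrow> real \<Rightarrow> complex" and G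
  proof -
    have eq: "contour_integral (h t) phi = F (pathfinish (h t)) - F z" for t
      using contour_integral_primitive[of UNIV F phi "h t"] F h
      by (simp add: contour_integral_unique)
    have "((\<lambda>t. F (pathfinish (h t)) - L) \<longlongrightarrow> 0) G"
    proof (rule Lim_null_comparison)
      have "\<forall>\<^sub>F t in G. 2 \<le> Re (pathfinish (h t))"
        using re by (simp add: filterlim_at_top)
      moreover have "\<forall>\<^sub>F t in G. \<bar>Im (pathfinish (h t))\<bar> < 1"
        using tendstoD[OF im, of 1] by simp
      ultimately show "\<forall>\<^sub>F t in G. norm (F (pathfinish (h t)) - L)
          \<le> exp (- Re (pathfinish (h t))) + exp (1/2) * \<bar>Im (pathfinish (h t))\<bar>"
        by eventually_elim (use L in auto)
      have "((\<lambda>x::real. exp (- x)) \<longlongrightarrow> 0) at_top" by real_asymp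
      from filterlim_compose[OF this re]
      have "((\<lambda>t. exp (- Re (pathfinish (h t)))) \<longlongrightarrow> 0) G" .
      from tendsto_add[OF this tendsto_mult_right_zero[OF tendsto_rabs_zero[OF im], of "exp (1/2)"]]
      show "((\<lambda>t. exp (- Re (pathfinish (h t))) + exp (1/2) * \<bar>Im (pathfinish (h t))\<bar>) \<longlongrightarrow> 0) G"
        by simp
    qed
    hence "((\<lambda>t. F (pathfinish (h t))) \<longlongrightarrow> L) G" by (rule LIM_zero_cancel)
    thus ?thesis unfolding eq by (intro tendsto_intros)
  qed
  have "((\<lambda>r::real. contour_integral (linepath z (of_real r)) phi) \<longlongrightarrow> L - F z) at_top"
    by (rule lim) (auto simp: filterlim_ident)
  hence "Psi z = L - F z" unfolding Psi_def by (intro tendsto_Lim) auto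
  with lim[OF assms] show ?thesis by simp
qed

end

(* Let M = Psi / phi = 1 / R, so that M' = z M - 1. Integration along horizontal rays gives
   |z M - 1| <= 2 / |z| on the closed right half-plane, so R - z is bounded far out and Cauchy's
   inequality on the circle of radius Re z / 2 yields the limit statement.
   The maximum principle for exp (- M) shows Re M >= 0; at a zero of M the derivative would be -1,
   so Re M would become negative to its right, hence M has no zeros.
   With c = sqrt (2 / pi), the function R / (z + c) tends to 1 at infinity, and on the imaginary
   axis its modulus is at most 1 by a one-variable inequality, so |R| <= |z + c| by the maximum
   principle. Cauchy's formula on circles of radius r -> Re z then bounds the n-th derivative by
   n! / r^n times the mean of |R| on the circle, and the mean of |z + c + r e^(it)|^2 is
   |z + c|^2 + r^2. *)
theory Submission
  imports Defs "HOL-Probability.Distributions"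
begin

section \<open>The Gaussian tail integral\<close>

lemma phi_nonzero: "phi z \<noteq> 0"
  by (simp add: phi_def)

lemma has_field_derivative_phi: "(phi has_field_derivative - z * phi z) (at z)"
  unfolding phi_def[abs_def] by (rule derivative_eq_intros refl | simp)+

lemma norm_phi: "norm (phi z) = exp (((Im z)\<^sup>2 - (Re z)\<^sup>2) / 2) / sqrt (2 * pi)"
proof -
  have "Re (- (z\<^sup>2) / 2) = ((Im z)\<^sup>2 - (Re z)\<^sup>2) / 2"
    by (simp add: Re_power2 diff_divide_distrib)
  then show ?thesis
    unfolding phi_def norm_divide norm_exp_eq_Re by simp
qed

text \<open>\<open>Psi z + F z\<close> is the limit of \<open>F\<close> along the positive real
  axis, so it does not depend on \<open>z\<close>. The limit in the definition of \<open>Psi\<close>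
  thus becomes a difference with an entire primitive.\<close>

lemma Psi_primitive:
  obtains F C where "\<And>z. (F has_field_derivative phi z) (at z)"
    and "\<And>z. Psi z = C - F z"
    and "((\<lambda>r::real. F (of_real r)) \<longlongrightarrow> C) at_top"
proof -
  obtain F where F: "\<And>z. (F has_field_derivative phi z) (at z)"
    using phi_primitive_ex by metis
  have lim: "((\<lambda>r::real. F (of_real r)) \<longlongrightarrow> Psi z + F z) at_top" for z
  proof -
    have "((\<lambda>r::real. contour_integral (linepath z (of_real r)) phi) \<longlongrightarrow> Psi z) at_top"
      by (rule Psi_limit_any_path) (auto simp: filterlim_ident)
    moreover have "contour_integral (linepath z (of_real r)) phi = F (of_real r) - F z" for r
      using contour_integral_primitive[of UNIV F phi "linepath z (of_real r)"] F
      by (simp add: contour_integral_unique)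
    ultimately have "((\<lambda>r::real. F (of_real r) - F z) \<longlongrightarrow> Psi z) at_top" by simp
    from tendsto_add[OF this tendsto_const[of "F z"]] show ?thesis by simp
  qed
  have "Psi z + F z = Psi 0 + F 0" for z
    by (rule tendsto_unique[OF trivial_limit_at_top_linorder lim lim])
  then have "Psi z = (Psi 0 + F 0) - F z" for z
    by (simp add: algebra_simps)
  then show ?thesis by (rule that[OF F _ lim])
qed

lemma has_field_derivative_Psi: "(Psi has_field_derivative - phi z) (at z)"
proof -
  obtain F C where F: "\<And>z. (F has_field_derivative phi z) (at z)"
    and C: "\<And>z. Psi z = C - F z"
    using Psi_primitive by metis
  have "((\<lambda>z. C - F z) has_field_derivative - phi z) (at z)"
    by (auto intro!: derivative_eq_intros F)
  then show ?thesis by (simp add: C[abs_def])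
qed

lemma Psi_tendsto_0_real: "((\<lambda>r::real. Psi (of_real r)) \<longlongrightarrow> 0) at_top"
proof -
  obtain F C where "\<And>z. Psi z = C - F z" "((\<lambda>r::real. F (of_real r)) \<longlongrightarrow> C) at_top"
    using Psi_primitive by metis
  then show ?thesis using tendsto_diff[of "\<lambda>_. C" C at_top "\<lambda>r::real. F (of_real r)" C] by simp
qed

text \<open>The vertical segment from \<open>z + t\<close> to the real axis has the fixed length
  \<open>\<bar>Im z\<bar>\<close>, and \<open>phi\<close> decays on it like a Gaussian in
  \<open>t\<close>; this carries the limit over from the real axis.\<close>

lemma Psi_tendsto_0: "((\<lambda>t::real. Psi (z + of_real t)) \<longlongrightarrow> 0) at_top"
proof -
  define B where "B t = exp (((Im z)\<^sup>2 - (Re z + t)\<^sup>2) / 2)" for t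
  have le: "norm (Psi (z + of_real t) - Psi (of_real (Re z + t))) \<le> B t * \<bar>Im z\<bar>" for t
  proof -
    have "norm (Psi (z + of_real t) - Psi (of_real (Re z + t)))
        \<le> B t * norm (z + of_real t - of_real (Re z + t))"
    proof (rule field_differentiable_bound[of "closed_segment (z + of_real t) (of_real (Re z + t))"])
      fix w assume "w \<in> closed_segment (z + of_real t) (of_real (Re z + t))"
      then obtain u where u: "0 \<le> u" "u \<le> 1"
        "w = (1 - u) *\<^sub>R (z + of_real t) + u *\<^sub>R of_real (Re z + t)"
        by (auto simp: closed_segment_def)
      have "Re w = (1 - u) * (Re z + t) + u * (Re z + t)" unfolding u(3) by simp
      then have Re: "Re w = Re z + t" by (simp add: algebra_simps)
      have Im: "Im w = (1 - u) * Im z" using u by simp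
      have "\<bar>Im w\<bar> \<le> \<bar>Im z\<bar>"
        unfolding Im abs_mult using u by (intro mult_left_le_one_le) auto
      then have "(Im w)\<^sup>2 \<le> (Im z)\<^sup>2" by (simp add: abs_le_square_iff)
      then have "exp (((Im w)\<^sup>2 - (Re w)\<^sup>2) / 2) \<le> B t" by (simp add: B_def Re)
      then show "norm (- phi w) \<le> B t" using norm_phi_le[of w] by simp
      show "(Psi has_field_derivative - phi w)
          (at w within closed_segment (z + of_real t) (of_real (Re z + t)))"
        using has_field_derivative_Psi has_field_derivative_at_within by blast
    qed auto
    also have "norm (z + of_real t - of_real (Re z + t)) = \<bar>Im z\<bar>" by (simp add: cmod_def)
    finally show ?thesis .
  qed
  have "(B \<longlongrightarrow> 0) at_top"
    unfolding B_def by real_asymp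
  then have "((\<lambda>t. B t * \<bar>Im z\<bar>) \<longlongrightarrow> 0) at_top"
    by (rule tendsto_mult_left_zero)
  then have "((\<lambda>t. Psi (z + of_real t) - Psi (of_real (Re z + t))) \<longlongrightarrow> 0) at_top"
    by (rule Lim_null_comparison[rotated]) (use le in auto)
  moreover have "((\<lambda>t. Psi (of_real (Re z + t))) \<longlongrightarrow> 0) at_top"
    by (rule filterlim_compose[OF Psi_tendsto_0_real]) real_asymp
  ultimately have "((\<lambda>t. (Psi (z + of_real t) - Psi (of_real (Re z + t)))
      + Psi (of_real (Re z + t))) \<longlongrightarrow> 0 + 0) at_top"
    by (rule tendsto_add)
  then show ?thesis by simp
qed

text \<open>One integration by parts: \<open>Psi w - phi w / w\<close> has derivative
  \<open>phi w / w\<^sup>2\<close> and vanishes at the end of the horizontal ray from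
  \<open>z\<close>, along which that derivative is at most \<open>K * exp (- t)\<close>.\<close>

lemma Psi_minus_phi_div_le:
  assumes "0 \<le> Re z" "z \<noteq> 0"
  shows "norm (Psi z - phi z / z) \<le> 2 * norm (phi z) / (norm z)\<^sup>2"
proof -
  define f where "f t = Psi (z + of_real t) - phi (z + of_real t) / (z + of_real t)" for t :: real
  define K where "K = norm (phi z) / (norm z)\<^sup>2 * exp (1 / 2)"
  have nz: "z + of_real t \<noteq> 0" if "0 \<le> t" for t :: real
    using assms that by (auto simp: complex_eq_iff)
  have norm_le: "norm z \<le> norm (z + of_real t)" if "0 \<le> t" for t :: real
    using assms that by (auto simp: cmod_def power_mono)
  have deriv: "(f has_vector_derivative phi (z + of_real t) / (z + of_real t)\<^sup>2) (at t)"
    if "0 \<le> t" for t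
  proof -
    define w where "w = z + of_real t"
    have w: "w \<noteq> 0" using nz[OF that] by (simp add: w_def)
    have "((\<lambda>w. Psi w - phi w / w) has_field_derivative phi w / w\<^sup>2) (at w)"
      by (rule derivative_eq_intros has_field_derivative_Psi has_field_derivative_phi w refl)+
        (use w in \<open>simp add: divide_simps power2_eq_square\<close>)
    then have "((\<lambda>s. Psi (z + s) - phi (z + s) / (z + s)) has_field_derivative
        phi w / w\<^sup>2) (at (of_real t))"
      using DERIV_shift[of "\<lambda>w. Psi w - phi w / w" "phi w / w\<^sup>2" "of_real t" z]
      by (simp only: w_def add.commute)
    then show ?thesis
      unfolding f_def[abs_def] w_def by (rule has_vector_derivative_real_field)
  qed
  have norm_deriv: "norm (phi (z + of_real t) / (z + of_real t)\<^sup>2) \<le> K * exp (- t)"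
    if "0 \<le> t" for t
  proof -
    \<comment> \<open>Gaussian decay is weakened to exponential decay by
      \<open>2 * t \<le> 1 + t\<^sup>2\<close>; this is the source of the factor
      \<open>exp (1 / 2)\<close> in \<open>K\<close>.\<close>
    have "0 \<le> (t - 1)\<^sup>2" "0 \<le> Re z * t" using assms that by auto
    then have "2 * t + (Re z)\<^sup>2 \<le> 1 + (Re z + t)\<^sup>2"
      by (simp add: power2_eq_square algebra_simps)
    then have "((Im z)\<^sup>2 - (Re z + t)\<^sup>2) / 2 \<le> ((Im z)\<^sup>2 - (Re z)\<^sup>2) / 2 + (1 / 2 + - t)"
      by argo
    then have "exp (((Im z)\<^sup>2 - (Re z + t)\<^sup>2) / 2)
        \<le> exp (((Im z)\<^sup>2 - (Re z)\<^sup>2) / 2) * (exp (1 / 2) * exp (- t))"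
      unfolding exp_add[symmetric] by simp
    then have "norm (phi (z + of_real t)) \<le> norm (phi z) * (exp (1 / 2) * exp (- t))"
      by (simp add: norm_phi divide_right_mono)
    moreover have "(norm z)\<^sup>2 \<le> (norm (z + of_real t))\<^sup>2"
      using norm_le[OF that] by (rule power_mono) simp
    ultimately have "norm (phi (z + of_real t)) / (norm (z + of_real t))\<^sup>2
        \<le> norm (phi z) * (exp (1 / 2) * exp (- t)) / (norm z)\<^sup>2"
      using assms by (intro frac_le) auto
    then show ?thesis by (simp add: K_def norm_divide norm_power)
  qed
  have "norm (f T - f 0) \<le> K" if "0 < T" for T
  proof -
    have "norm (f T - f 0) \<le> - K * exp (- T) - (- K * exp (- 0))"
    proof (rule differentiable_bound_general[OF that, where
          f' = "\<lambda>t. phi (z + of_real t) / (z + of_real t)\<^sup>2" and \<phi>' = "\<lambda>t. K * exp (- t)"])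
      show "continuous_on {0..T} f"
        by (intro continuous_at_imp_continuous_on ballI
            has_vector_derivative_continuous[OF deriv]) auto
      show "((\<lambda>t. - K * exp (- t)) has_vector_derivative K * exp (- t)) (at t)" for t :: real
        unfolding has_real_derivative_iff_has_vector_derivative[symmetric]
        by (auto intro!: derivative_eq_intros)
      show "continuous_on {0..T} (\<lambda>t. - K * exp (- t))" by (intro continuous_intros)
      fix t assume t: "0 < t" "t < T"
      show "(f has_vector_derivative phi (z + of_real t) / (z + of_real t)\<^sup>2) (at t)"
        using t by (intro deriv) simp
      show "norm (phi (z + of_real t) / (z + of_real t)\<^sup>2) \<le> K * exp (- t)"
        using t by (intro norm_deriv) simp
    qed
    also have "\<dots> \<le> K" by (simp add: K_def)
    finally show ?thesis .
  qed
  moreover have "(f \<longlongrightarrow> 0) at_top"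
  proof -
    have "((\<lambda>t. exp (- t) * (a + t)) \<longlongrightarrow> 0) at_top" for a :: real
      by real_asymp
    then have lim: "((\<lambda>t. K * (exp (- t) * (norm z + t))) \<longlongrightarrow> 0) at_top"
      by (intro tendsto_mult_right_zero)
    \<comment> \<open>With \<open>w = z + t\<close>, writing \<open>phi w / w\<close> as
      \<open>(phi w / w\<^sup>2) * w\<close> lets \<open>norm_deriv\<close> serve again:
      \<open>exp (- t)\<close> absorbs the linear growth of \<open>w\<close>.\<close>
    have "((\<lambda>t. phi (z + of_real t) / (z + of_real t)) \<longlongrightarrow> 0) at_top"
    proof (rule Lim_null_comparison[OF _ lim])
      show "\<forall>\<^sub>F t in at_top. norm (phi (z + of_real t) / (z + of_real t))
          \<le> K * (exp (- t) * (norm z + t))"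
        using eventually_ge_at_top[of 0]
      proof eventually_elim
        case (elim t)
        have "norm (phi (z + of_real t) / (z + of_real t))
            = norm (phi (z + of_real t) / (z + of_real t)\<^sup>2) * norm (z + of_real t)"
          using nz[OF elim] by (simp add: norm_divide norm_mult power2_eq_square)
        also have "\<dots> \<le> K * exp (- t) * (norm z + t)"
          using norm_deriv[OF elim] norm_triangle_ineq[of z "of_real t"] elim
          by (intro mult_mono) (auto simp: K_def)
        finally show ?case by (simp add: mult.assoc)
      qed
    qed
    from tendsto_diff[OF Psi_tendsto_0 this] show ?thesis by (simp add: f_def[abs_def])
  qed
  ultimately have "norm (0 - f 0) \<le> K"
    by (intro Lim_norm_ubound[OF _ tendsto_diff[OF _ tendsto_const]])
      (auto intro: eventually_mono[OF eventually_gt_at_top[of 0]])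
  moreover have "K \<le> norm (phi z) / (norm z)\<^sup>2 * 2"
  proof -
    have "exp (1 / 2 :: real) \<le> 2"
      by (rule exp_half_le2)
    then show ?thesis unfolding K_def by (intro mult_left_mono) auto
  qed
  ultimately show ?thesis by (simp add: f_def norm_minus_commute mult.commute)
qed

section \<open>Bounds on half-planes and circles\<close>

text \<open>Maximum modulus on a large half-disc: its frontier consists of points of the imaginary
  axis and of points far out, and \<open>1 + e\<close> bounds \<open>f\<close> at both.\<close>

lemma norm_le_1_right_halfplane:
  assumes holo: "f holomorphic_on {z. 0 < Re z}"
    and cont: "continuous_on {z. 0 \<le> Re z} f"
    and axis: "\<And>z. Re z = 0 \<Longrightarrow> norm (f z) \<le> 1"
    and infinity: "\<And>e. 0 < e \<Longrightarrow> \<exists>r. \<forall>z. 0 \<le> Re z \<longrightarrow> r \<le> norm z \<longrightarrow> norm (f z) \<le> 1 + e"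
    and z: "0 \<le> Re z"
  shows "norm (f z) \<le> 1"
proof (rule field_le_epsilon)
  fix e :: real
  assume e: "0 < e"
  then obtain r where r: "\<And>z. 0 \<le> Re z \<Longrightarrow> r \<le> norm z \<Longrightarrow> norm (f z) \<le> 1 + e"
    using infinity by blast
  \<comment> \<open>At least \<open>norm z\<close>, to keep \<open>z\<close> in the half-disc; at
    least \<open>r\<close>, so that the bound at infinity holds on the arc.\<close>
  define \<rho> where "\<rho> = max r (norm z)"
  define S where "S = {z. 0 \<le> Re z} \<inter> cball 0 \<rho>"
  have half: "{z. 0 \<le> Re z} = {z. 0 \<le> 1 \<bullet> z}"
    by (simp add: inner_complex_def)
  have closed: "closed S"
    unfolding S_def half by (intro closed_Int closed_halfspace_ge closed_cball)
  have "interior {z. 0 \<le> Re z} = {z. 0 < Re z}"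
    using interior_halfspace_ge[of "1::complex" 0] by (simp add: inner_complex_def)
  then have int: "interior S = {z. 0 < Re z} \<inter> ball 0 \<rho>"
    unfolding S_def by simp
  show "norm (f z) \<le> 1 + e"
  proof (rule maximum_modulus_frontier[where S = S and f = f and \<xi> = z])
    show "f holomorphic_on interior S"
      unfolding int by (rule holomorphic_on_subset[OF holo]) auto
    have "closure S \<subseteq> {z. 0 \<le> Re z}"
      using closed by (simp add: S_def)
    then show "continuous_on (closure S) f"
      by (rule continuous_on_subset[OF cont])
    show "bounded S"
      unfolding S_def by (intro bounded_Int) simp
    show "z \<in> S" using z by (simp add: S_def \<rho>_def)
    fix w assume "w \<in> frontier S"
    then have w: "w \<in> S" "w \<notin> interior S"
      using closed by (auto simp: frontier_def)
    then have "0 \<le> Re w" "Re w = 0 \<or> r \<le> norm w"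
      unfolding int by (auto simp: S_def \<rho>_def)
    then show "norm (f w) \<le> 1 + e"
      using e axis[of w] r[of w] by linarith
  qed
qed

text \<open>Cauchy's formula leaves the mean of \<open>norm (z + c + e x)\<close>, which is at most
  its quadratic mean \<open>s\<close>. Instead of the Cauchy-Schwarz inequality, a pointwise
  majorant with integral \<open>s\<close> is used.\<close>

lemma norm_higher_deriv_le_affine:
  assumes holo: "f holomorphic_on ball z r" and cont: "continuous_on (cball z r) f" and r: "0 < r"
    and bound: "\<And>u. norm (u - z) = r \<Longrightarrow> norm (f u) \<le> norm (u + c)"
  shows "norm ((deriv ^^ n) f z) \<le> fact n / r ^ n * sqrt ((norm (z + c))\<^sup>2 + r\<^sup>2)"
proof -
  define s where "s = sqrt ((norm (z + c))\<^sup>2 + r\<^sup>2)"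
  have s: "0 < s" "s\<^sup>2 = (norm (z + c))\<^sup>2 + r\<^sup>2"
    using r by (auto simp: s_def intro!: add_nonneg_pos)
  define e where "e x = of_real r * exp (2 * of_real pi * \<i> * of_real x)" for x :: real
  have ne: "norm (e x) = r" for x
    using r by (simp add: e_def norm_mult)
  have ez: "e x \<noteq> 0" for x
    using ne[of x] r by auto
  define d where "d x = f (z + e x) / e x ^ Suc n * (2 * of_real pi * \<i> * e x)" for x
  have "((\<lambda>u. f u / (u - z) ^ Suc n) has_contour_integral
      (2 * pi * \<i> / fact n * (deriv ^^ n) f z)) (circlepath z r)"
    using Cauchy_has_contour_integral_higher_derivative_circlepath[OF cont holo, of z n] r by simp
  then have d: "(d has_integral (2 * pi * \<i> / fact n * (deriv ^^ n) f z)) {0..1}"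
    unfolding has_contour_integral vector_derivative_circlepath
    by (simp add: circlepath d_def[abs_def] e_def mult_ac)
  \<comment> \<open>The vanishing integral of 1 over the circle says that \<open>e\<close> has mean
    0; hence so has the cross term \<open>Re (cnj (z + c) * e x)\<close>.\<close>
  have "((\<lambda>u. 1) has_contour_integral 0) (circlepath z r)"
    using contour_integral_primitive[of UNIV "\<lambda>u. u" "\<lambda>u. 1" "circlepath z r"]
    by (simp add: DERIV_ident)
  moreover define K where "K = 2 * of_real pi * \<i>"
  ultimately have "((\<lambda>x. K * e x) has_integral 0) {0..1}"
    unfolding has_contour_integral vector_derivative_circlepath by (simp add: e_def mult_ac)
  moreover have "bounded_linear (\<lambda>u. Re (cnj (z + c) * (u / K)))"
    by (intro bounded_linear_compose[OF bounded_linear_Re]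
        bounded_linear_compose[OF bounded_linear_mult_right] bounded_linear_divide)
  ultimately have "((\<lambda>u. Re (cnj (z + c) * (u / K))) \<circ> (\<lambda>x. K * e x)
      has_integral Re (cnj (z + c) * (0 / K))) {0..1}"
    by (rule has_integral_linear)
  moreover have "K \<noteq> 0" by (simp add: K_def)
  ultimately have "((\<lambda>x. Re (cnj (z + c) * e x)) has_integral 0) {0..1}"
    by (simp add: o_def)
  from has_integral_mult_right[OF has_integral_add[OF has_integral_const_real[of s 0 1]
        has_integral_mult_right[OF this, of "1 / s"]], of "2 * pi / r ^ n"]
  have g: "((\<lambda>x. 2 * pi / r ^ n * (s + 1 / s * Re (cnj (z + c) * e x)))
      has_integral 2 * pi / r ^ n * s) {0..1}" by simp
  have "norm (2 * pi * \<i> / fact n * (deriv ^^ n) f z) \<le> 2 * pi / r ^ n * s"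
    unfolding integral_unique[OF d, symmetric] integral_unique[OF g, symmetric]
  proof (rule integral_norm_bound_integral)
    fix x :: real
    \<comment> \<open>AM-GM, \<open>2 s norm w \<le> (norm w)\<^sup>2 + s\<^sup>2\<close>; the cross term in \<open>(norm w)\<^sup>2\<close> has mean 0 on the circle.\<close>
    have "(norm (z + c + e x))\<^sup>2 = s\<^sup>2 + 2 * Re (cnj (z + c) * e x)"
      unfolding s(2) ne[of x, symmetric] cmod_power2 by (simp add: power2_eq_square algebra_simps)
    moreover have "0 \<le> (norm (z + c + e x) - s)\<^sup>2" by simp
    ultimately have "2 * s * norm (z + c + e x) \<le> 2 * s\<^sup>2 + 2 * Re (cnj (z + c) * e x)"
      by (simp add: power2_eq_square algebra_simps)
    then have "norm (z + c + e x) \<le> s + 1 / s * Re (cnj (z + c) * e x)"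
      using s(1) by (simp add: field_simps power2_eq_square)
    moreover have "norm (f (z + e x)) \<le> norm (z + c + e x)"
      using bound[of "z + e x"] by (simp add: ne add_ac)
    ultimately have "norm (f (z + e x)) \<le> s + 1 / s * Re (cnj (z + c) * e x)"
      by linarith
    moreover have "norm (d x) = 2 * pi / r ^ n * norm (f (z + e x))"
      using ez[of x] r by (simp add: d_def norm_mult norm_divide norm_power ne)
    ultimately show "norm (d x) \<le> 2 * pi / r ^ n * (s + 1 / s * Re (cnj (z + c) * e x))"
      using r by (simp only:) (intro mult_left_mono, simp_all)
  qed (use d g in \<open>blast dest: has_integral_integrable\<close>)+
  then have "2 * pi * (norm ((deriv ^^ n) f z) / fact n) \<le> 2 * pi * (s / r ^ n)"
    by (simp add: norm_mult norm_divide)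
  then have "norm ((deriv ^^ n) f z) / fact n \<le> s / r ^ n"
    by (subst (asm) mult_le_cancel_left_pos) simp_all
  then show ?thesis by (simp add: field_simps s_def)
qed

section \<open>The one-variable inequality behind the bound on the imaginary axis\<close>

text \<open>Equality holds at 0. The derivative of the difference \<open>P\<close> of the two sides
  has the sign of \<open>D\<close>, which is increasing and vanishes at 0, so \<open>P\<close> is
  least at 0.\<close>

lemma mills_real_inequality:
  fixes E :: "real \<Rightarrow> real"
  assumes E: "\<And>y. (E has_real_derivative exp (y\<^sup>2 / 2)) (at y)" and E0: "E 0 = 0"
  shows "exp (y\<^sup>2) / (y\<^sup>2 + 2 / pi) \<le> pi / 2 + (E y)\<^sup>2"
proof -
  define a where "a = 2 / pi"
  define u where "u y = y\<^sup>2 + a" for y :: real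
  have a: "3 / 5 < a"
    using pi_approx by (simp add: a_def field_simps)
  have u: "0 < u y" for y using a by (simp add: u_def add_nonneg_pos)
  have du: "(u has_real_derivative 2 * y) (at y)" for y
    unfolding u_def[abs_def] by (auto intro!: derivative_eq_intros)
  have du2: "((\<lambda>y. (u y)\<^sup>2) has_real_derivative 2 * u y * (2 * y)) (at y)" for y
    using DERIV_power[OF du, of 2] by (simp add: mult_ac)
  have dg: "((\<lambda>y. exp (y\<^sup>2 / 2)) has_real_derivative y * exp (y\<^sup>2 / 2)) (at y)" for y :: real
    by (auto intro!: derivative_eq_intros)
  have dg2: "((\<lambda>y. (exp (y\<^sup>2 / 2))\<^sup>2) has_real_derivative
      2 * exp (y\<^sup>2 / 2) * (y * exp (y\<^sup>2 / 2))) (at y)" for y :: real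
    using DERIV_power[OF dg, of 2] by (simp add: mult_ac)
  have dE2: "((\<lambda>y. (E y)\<^sup>2) has_real_derivative 2 * E y * exp (y\<^sup>2 / 2)) (at y)" for y
    using DERIV_power[OF E, of 2] by (simp add: mult_ac)
  \<comment> \<open>\<open>P' = 2 exp (y\<^sup>2 / 2) D\<close>, and \<open>D'\<close> is a positive multiple of a quadratic in \<open>u\<close> whose
    discriminant is negative because \<open>a > 3/5\<close>.\<close>
  define D where "D y = E y - exp (y\<^sup>2 / 2) * (y / u y - y / (u y)\<^sup>2)" for y
  define P where "P y = pi / 2 + (E y)\<^sup>2 - (exp (y\<^sup>2 / 2))\<^sup>2 / u y" for y
  have quadratic: "0 < (2 + a) * v\<^sup>2 - 3 * (1 + a) * v + 4 * a" for v
  proof -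
    \<comment> \<open>Completing the square after multiplication by \<open>4 * (2 + a)\<close>. The
      remaining constant is positive exactly when \<open>9 < 7 * a\<^sup>2 + 14 * a\<close>.\<close>
    have "0 \<le> (2 * (2 + a) * v - 3 * (1 + a))\<^sup>2" by simp
    moreover have "9 * (1 + a)\<^sup>2 < 16 * a * (2 + a)"
    proof -
      have "3 / 5 * (3 / 5) < a * a" using a by (intro mult_strict_mono) auto
      then show ?thesis using a by (simp add: power2_eq_square algebra_simps)
    qed
    ultimately have "0 < 4 * (2 + a) * ((2 + a) * v\<^sup>2 - 3 * (1 + a) * v + 4 * a)"
      by (simp add: power2_eq_square algebra_simps)
    then show ?thesis using a by (simp add: zero_less_mult_iff)
  qed
  have dD: "(D has_real_derivative exp (y\<^sup>2 / 2) *
      (((2 + a) * (u y)\<^sup>2 - 3 * (1 + a) * u y + 4 * a) / u y ^ 3)) (at y)" for y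
  proof -
    have "(D has_real_derivative exp (y\<^sup>2 / 2) - (y * exp (y\<^sup>2 / 2) * (y / u y - y / (u y)\<^sup>2)
        + ((1 * u y - y * (2 * y)) / (u y * u y)
          - (1 * (u y)\<^sup>2 - y * (2 * u y * (2 * y))) / ((u y)\<^sup>2 * (u y)\<^sup>2)) * exp (y\<^sup>2 / 2))) (at y)"
      unfolding D_def[abs_def] using u[of y]
      by (intro DERIV_diff DERIV_mult DERIV_divide E dg DERIV_ident du du2) auto
    moreover have "exp (y\<^sup>2 / 2) - (y * exp (y\<^sup>2 / 2) * (y / u y - y / (u y)\<^sup>2)
        + ((1 * u y - y * (2 * y)) / (u y * u y)
          - (1 * (u y)\<^sup>2 - y * (2 * u y * (2 * y))) / ((u y)\<^sup>2 * (u y)\<^sup>2)) * exp (y\<^sup>2 / 2))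
      = exp (y\<^sup>2 / 2) * (1 - y\<^sup>2 * (1 / u y - 1 / (u y)\<^sup>2)
        - (1 / u y - 2 * y\<^sup>2 / (u y)\<^sup>2 - 1 / (u y)\<^sup>2 + 4 * y\<^sup>2 / u y ^ 3))"
      using u[of y] by (simp add: field_simps power2_eq_square power3_eq_cube)
    moreover have "1 - y\<^sup>2 * (1 / u y - 1 / (u y)\<^sup>2)
        - (1 / u y - 2 * y\<^sup>2 / (u y)\<^sup>2 - 1 / (u y)\<^sup>2 + 4 * y\<^sup>2 / u y ^ 3)
      = ((2 + a) * (u y)\<^sup>2 - 3 * (1 + a) * u y + 4 * a) / u y ^ 3"
    proof -
      \<comment> \<open>Replacing \<open>y\<^sup>2\<close> by \<open>v - a\<close> makes this a
        rational identity in the single variable \<open>v = u y\<close>.\<close>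
      have "1 - (v - a) * (1 / v - 1 / v\<^sup>2)
          - (1 / v - 2 * (v - a) / v\<^sup>2 - 1 / v\<^sup>2 + 4 * (v - a) / v ^ 3)
        = ((2 + a) * v\<^sup>2 - 3 * (1 + a) * v + 4 * a) / v ^ 3" if "0 < v" for v
        using that by (simp add: field_simps power2_eq_square power3_eq_cube)
      from this[OF u[of y]] show ?thesis by (simp add: u_def)
    qed
    ultimately show ?thesis by simp
  qed
  have D_mono: "D x \<le> D y" if "x \<le> y" for x y
  proof (rule DERIV_nonneg_imp_nondecreasing[OF that], intro exI conjI)
    fix t
    show "0 \<le> exp (t\<^sup>2 / 2) * (((2 + a) * (u t)\<^sup>2 - 3 * (1 + a) * u t + 4 * a) / u t ^ 3)"
      using quadratic[of "u t"] u[of t] by (intro mult_nonneg_nonneg divide_nonneg_pos) simp_all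
  qed (rule dD)
  have D0: "D 0 = 0" by (simp add: D_def E0)
  have dP: "(P has_real_derivative 2 * exp (y\<^sup>2 / 2) * D y) (at y)" for y
  proof -
    have "(P has_real_derivative 0 + 2 * E y * exp (y\<^sup>2 / 2)
        - ((2 * exp (y\<^sup>2 / 2) * (y * exp (y\<^sup>2 / 2))) * u y - (exp (y\<^sup>2 / 2))\<^sup>2 * (2 * y)) / (u y * u y)) (at y)"
      unfolding P_def[abs_def] using u[of y]
      by (intro DERIV_diff DERIV_add DERIV_divide DERIV_const du dg2 dE2) auto
    moreover have "0 + 2 * E y * exp (y\<^sup>2 / 2)
        - ((2 * exp (y\<^sup>2 / 2) * (y * exp (y\<^sup>2 / 2))) * u y - (exp (y\<^sup>2 / 2))\<^sup>2 * (2 * y)) / (u y * u y)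
        = 2 * exp (y\<^sup>2 / 2) * D y"
      using u[of y] by (simp add: D_def divide_simps) (simp add: power2_eq_square algebra_simps)
    ultimately show ?thesis by simp
  qed
  have "P 0 \<le> P y"
  proof (cases "0 \<le> y")
    case True
    show ?thesis
    proof (rule DERIV_nonneg_imp_nondecreasing[OF True], intro exI conjI)
      fix t :: real
      assume "0 \<le> t"
      then show "0 \<le> 2 * exp (t\<^sup>2 / 2) * D t"
        using D_mono[of 0 t] D0 by (intro mult_nonneg_nonneg) simp_all
    qed (rule dP)
  next
    case False
    then have "y \<le> 0" by simp
    show ?thesis
    proof (rule DERIV_nonpos_imp_nonincreasing[OF \<open>y \<le> 0\<close>], intro exI conjI)
      fix t :: real
      assume "t \<le> 0"
      then show "2 * exp (t\<^sup>2 / 2) * D t \<le> 0"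
        using D_mono[of t 0] D0 by (intro mult_nonneg_nonpos) simp_all
    qed (rule dP)
  qed
  moreover have "P 0 = 0" by (simp add: P_def u_def E0 a_def)
  moreover have "(exp (y\<^sup>2 / 2))\<^sup>2 = exp (y\<^sup>2)"
    by (simp add: exp_double[symmetric])
  ultimately show ?thesis by (simp add: P_def u_def a_def)
qed

section \<open>Psi on the coordinate axes\<close>

lemma tendsto_Re_Psi_real: "((\<lambda>r::real. Re (Psi (of_real r))) \<longlongrightarrow> 0) at_top"
  and tendsto_Im_Psi_real: "((\<lambda>r::real. Im (Psi (of_real r))) \<longlongrightarrow> 0) at_top"
  using tendsto_Re[OF Psi_tendsto_0_real] tendsto_Im[OF Psi_tendsto_0_real] by simp_all

lemma phi_of_real: "phi (of_real x) = of_real (exp (- (x\<^sup>2) / 2) / sqrt (2 * pi))"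
  by (simp add: phi_def flip: exp_of_real)

lemma phi_imaginary: "phi (\<i> * of_real y) = of_real (exp (y\<^sup>2 / 2) / sqrt (2 * pi))"
  by (simp add: phi_def power_mult_distrib flip: exp_of_real)

text \<open>The factor \<open>c\<close> selects the line and its scale: 1 and \<open>sqrt 2\<close>
  for the real axis, the imaginary unit for the imaginary axis.\<close>

lemma has_vector_derivative_Psi_line:
  "((\<lambda>x::real. Psi (c * of_real x)) has_vector_derivative - phi (c * of_real x) * c) (at x)"
proof (rule has_vector_derivative_real_field)
  show "((\<lambda>w. Psi (c * w)) has_field_derivative - phi (c * of_real x) * c) (at (of_real x))"
    by (rule DERIV_chain2[OF has_field_derivative_Psi]) (rule derivative_eq_intros refl | simp)+
qed

lemma has_real_derivative_Psi_line:
  shows "((\<lambda>x::real. Re (Psi (c * of_real x))) has_real_derivative Re (- phi (c * of_real x) * c)) (at x)"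
    and "((\<lambda>x::real. Im (Psi (c * of_real x))) has_real_derivative Im (- phi (c * of_real x) * c)) (at x)"
  unfolding has_real_derivative_iff_has_vector_derivative
  using bounded_linear.has_vector_derivative[OF bounded_linear_Re has_vector_derivative_Psi_line]
    bounded_linear.has_vector_derivative[OF bounded_linear_Im has_vector_derivative_Psi_line]
  by blast+

text \<open>The real part is half the Gaussian integral. The imaginary part is constant along the
  real axis, where \<open>phi\<close> is real, and tends to 0.\<close>

lemma Psi_0: "Psi 0 = 1 / 2"
proof -
  \<comment> \<open>The scaling by \<open>sqrt 2\<close> and the factor \<open>sqrt pi\<close> make
    \<open>H\<close> a primitive of \<open>exp (- x\<^sup>2)\<close> that vanishes at
    infinity.\<close>
  define H where "H x = - (sqrt pi * Re (Psi (of_real (sqrt 2) * of_real x)))" for x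
  have dH: "(H has_real_derivative exp (- x\<^sup>2)) (at x)" for x
  proof -
    have "phi (of_real (sqrt 2) * of_real x) = of_real (exp (- x\<^sup>2) / sqrt (2 * pi))"
      using phi_of_real[of "sqrt 2 * x"] by (simp add: power_mult_distrib)
    moreover have "(H has_real_derivative
        - (sqrt pi * Re (- phi (of_real (sqrt 2) * of_real x) * of_real (sqrt 2)))) (at x)"
      unfolding H_def[abs_def]
      by (intro DERIV_minus DERIV_cmult has_real_derivative_Psi_line)
    ultimately show ?thesis
      by (simp add: real_sqrt_mult)
  qed
  have "((\<lambda>x. Re (Psi (of_real (sqrt 2 * x)))) \<longlongrightarrow> 0) at_top"
    by (rule filterlim_compose[OF tendsto_Re_Psi_real]) real_asymp
  then have "(H \<longlongrightarrow> - (sqrt pi * 0)) at_top"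
    unfolding H_def[abs_def] by (intro tendsto_intros) simp
  then have "(\<integral>\<^sup>+x. ennreal (exp (- x\<^sup>2)) * indicator {0..} x \<partial>lborel) = ennreal (0 - H 0)"
    using dH by (intro nn_integral_FTC_atLeast) auto
  moreover have "(\<integral>\<^sup>+x. ennreal (exp (- x\<^sup>2)) * indicator {0..} x \<partial>lborel) = ennreal (sqrt pi / 2)"
  proof -
    have "(\<integral>\<^sup>+x. ennreal (indicator {0..} x *\<^sub>R exp (- x\<^sup>2)) \<partial>lborel) = ennreal (sqrt pi / 2)"
      using gaussian_moment_0 nn_integral_eq_integral[of lborel "\<lambda>x. indicator {0..} x *\<^sub>R exp (- x\<^sup>2) :: real"]
      by (simp add: has_bochner_integral_iff)
    moreover have "ennreal (indicator {0..} x *\<^sub>R exp (- x\<^sup>2)) = ennreal (exp (- x\<^sup>2)) * indicator {0..} x" for x :: real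
      by (simp add: indicator_def)
    ultimately show ?thesis by simp
  qed
  ultimately have "ennreal (sqrt pi / 2) = ennreal (- H 0)" by simp
  \<comment> \<open>\<open>ennreal\<close> sends negative reals to 0; positivity of the left side
    excludes this for \<open>- H 0\<close>.\<close>
  moreover have "0 < sqrt pi / 2" by simp
  ultimately have "sqrt pi / 2 = - H 0"
    by (metis ennreal_eq_0_iff ennreal_inj less_eq_real_def linorder_not_less)
  then have "sqrt pi * (1 / 2) = sqrt pi * Re (Psi 0)" by (simp add: H_def)
  then have Re: "Re (Psi 0) = 1 / 2" by (subst (asm) mult_left_cancel) auto
  have "Im (Psi (1 * of_real x)) = Im (Psi (1 * of_real 0))" for x
    by (rule DERIV_isconst_all) (use has_real_derivative_Psi_line(2)[of 1] in \<open>simp add: phi_of_real\<close>)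
  then have "((\<lambda>x::real. Im (Psi 0)) \<longlongrightarrow> 0) at_top"
    using tendsto_Im_Psi_real by simp
  then have "Im (Psi 0) = 0" by (simp add: tendsto_const_iff)
  with Re show ?thesis by (simp add: complex_eq_iff)
qed

text \<open>On the imaginary axis \<open>phi\<close> is real, so the derivative of
  \<open>Psi\<close> along that axis is purely imaginary.\<close>

lemma Re_Psi_imaginary: "Re (Psi (\<i> * of_real y)) = 1 / 2"
proof -
  have "Re (Psi (\<i> * of_real y)) = Re (Psi (\<i> * of_real 0))"
    by (rule DERIV_isconst_all) (use has_real_derivative_Psi_line(1)[of \<i>] in \<open>simp add: phi_imaginary\<close>)
  then show ?thesis by (simp add: Psi_0)
qed

section \<open>The Mills ratio\<close>

text \<open>Entire because \<open>phi\<close> has no zeros, so it can be studied before the zeros of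
  \<open>Psi\<close> are excluded.\<close>

definition mills :: "complex \<Rightarrow> complex" where
  "mills z = Psi z / phi z"

text \<open>Where \<open>Psi\<close> vanishes, both sides are 0 by the convention for division by
  0.\<close>

lemma R_eq_inverse_mills: "R z = 1 / mills z"
  by (simp add: R_def mills_def)

lemma has_field_derivative_mills: "(mills has_field_derivative z * mills z - 1) (at z)"
proof -
  have "(mills has_field_derivative
      (- phi z * phi z - Psi z * (- z * phi z)) / (phi z * phi z)) (at z)"
    unfolding mills_def[abs_def]
    by (intro DERIV_divide has_field_derivative_Psi has_field_derivative_phi phi_nonzero)
  then show ?thesis
    using phi_nonzero[of z] by (simp add: mills_def diff_divide_distrib mult.commute)
qed

lemma mills_holomorphic: "mills holomorphic_on A"
  using has_field_derivative_mills
  by (auto simp: holomorphic_on_def field_differentiable_def intro: has_field_derivative_at_within)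

lemma mills_asymptotic:
  assumes "0 \<le> Re z" "z \<noteq> 0"
  shows "norm (z * mills z - 1) \<le> 2 / norm z"
proof -
  have "z * mills z - 1 = z * (Psi z - phi z / z) / phi z"
    using assms phi_nonzero[of z] by (simp add: mills_def field_simps)
  also have "norm \<dots> \<le> norm z * (2 * norm (phi z) / (norm z)\<^sup>2) / norm (phi z)"
    using Psi_minus_phi_div_le[OF assms]
    by (simp only: norm_mult norm_divide) (intro divide_right_mono mult_left_mono, simp_all)
  also have "\<dots> = 2 / norm z"
    using assms phi_nonzero[of z] by (simp add: power2_eq_square)
  finally show ?thesis .
qed

lemma norm_mills_le:
  assumes "0 \<le> Re z" "1 \<le> norm z"
  shows "norm (mills z) \<le> 3 / norm z"
proof -
  have z: "z \<noteq> 0" using assms(2) by auto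
  have "norm (z * mills z) \<le> norm (z * mills z - 1) + 1"
    using norm_triangle_ineq[of "z * mills z - 1" 1] by simp
  also have "\<dots> \<le> 2 / norm z + 1"
    using mills_asymptotic[OF assms(1) z] by simp
  also have "\<dots> \<le> 3"
    using assms(2) z by (simp add: pos_divide_le_eq)
  finally show ?thesis
    using z by (simp add: norm_mult field_simps)
qed

lemma Re_mills_imaginary: "0 < Re (mills (\<i> * of_real y))"
  using Re_Psi_imaginary[of y] by (simp add: mills_def phi_imaginary)

lemma Re_eq_0_imp_imaginary: "Re z = 0 \<Longrightarrow> z = \<i> * of_real (Im z)"
  by (simp add: complex_eq_iff)

section \<open>Absence of zeros in the closed right half-plane\<close>

text \<open>\<open>exp (- mills z)\<close> has modulus \<open>exp (- Re (mills z))\<close>, which is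
  below 1 on the imaginary axis and tends to 1 at infinity.\<close>

lemma Re_mills_nonneg:
  assumes "0 \<le> Re z"
  shows "0 \<le> Re (mills z)"
proof -
  have "norm (exp (- mills z)) \<le> 1"
  proof (rule norm_le_1_right_halfplane[OF _ _ _ _ assms])
    show "(\<lambda>z. exp (- mills z)) holomorphic_on {z. 0 < Re z}"
      by (intro holomorphic_intros mills_holomorphic)
    show "continuous_on {z. 0 \<le> Re z} (\<lambda>z. exp (- mills z))"
      by (intro continuous_intros holomorphic_on_imp_continuous_on mills_holomorphic)
    show "norm (exp (- mills w)) \<le> 1" if "Re w = 0" for w
      using Re_mills_imaginary[of "Im w"] Re_eq_0_imp_imaginary[OF that]
      by (simp add: norm_exp_eq_Re)
    fix e :: real
    assume e: "0 < e"
    show "\<exists>r. \<forall>w. 0 \<le> Re w \<longrightarrow> r \<le> norm w \<longrightarrow> norm (exp (- mills w)) \<le> 1 + e"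
    proof (intro exI allI impI)
      fix w
      \<comment> \<open>The threshold makes \<open>3 / norm w\<close>, which bounds
        \<open>norm (mills w)\<close>, at most \<open>ln (1 + e)\<close>.\<close>
      assume w: "0 \<le> Re w" "max 1 (3 / ln (1 + e)) \<le> norm w"
      have "0 < ln (1 + e)" using e by simp
      then have "3 / norm w \<le> ln (1 + e)"
        using w(2) e by (subst pos_divide_le_eq) (auto simp: pos_divide_le_eq mult.commute)
      moreover have "norm (mills w) \<le> 3 / norm w"
        using w by (intro norm_mills_le) simp_all
      ultimately have "Re (- mills w) \<le> ln (1 + e)"
        using complex_Re_le_cmod[of "- mills w"] by simp
      then have "exp (Re (- mills w)) \<le> exp (ln (1 + e))" by (simp only: exp_le_cancel_iff)
      then show "norm (exp (- mills w)) \<le> 1 + e"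
        using e by (simp add: norm_exp_eq_Re)
    qed
  qed
  then show ?thesis by (simp add: norm_exp_eq_Re)
qed

text \<open>At a zero the differential equation gives derivative -1, so \<open>Re (mills w)\<close>
  is negative just to the right, still inside the half-plane.\<close>

lemma mills_nonzero:
  assumes "0 \<le> Re z"
  shows "mills z \<noteq> 0"
proof
  assume 0: "mills z = 0"
  have "((\<lambda>w. mills (w + z)) has_field_derivative -1) (at (of_real 0))"
    using has_field_derivative_mills[of z] DERIV_shift[of mills "-1" 0 z] by (simp add: 0)
  then have "((\<lambda>t::real. mills (of_real t + z)) has_vector_derivative -1) (at 0)"
    by (rule has_vector_derivative_real_field)
  from bounded_linear.has_vector_derivative[OF bounded_linear_Re this]
  have "((\<lambda>t::real. Re (mills (of_real t + z))) has_real_derivative -1) (at 0)"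
    by (simp add: has_real_derivative_iff_has_vector_derivative)
  from DERIV_neg_dec_right[OF this]
  obtain d where d: "0 < d" "\<And>h. 0 < h \<Longrightarrow> h < d \<Longrightarrow> Re (mills (of_real h + z)) < 0"
    using 0 by auto
  have "0 \<le> Re (mills (of_real (d / 2) + z))"
    using assms d(1) by (intro Re_mills_nonneg) simp
  with d(2)[of "d / 2"] d(1) show False by simp
qed

text \<open>At \<open>z = \<i> * y\<close>, \<open>Re (Psi z)\<close> is 1/2 and
  \<open>Im (Psi z)\<close> is a multiple of \<open>E y\<close>; squaring the claim gives
  \<open>mills_real_inequality\<close>.\<close>

lemma norm_mills_imaginary:
  assumes "Re z = 0"
  shows "1 \<le> norm ((z + of_real (sqrt (2 / pi))) * mills z)"
proof -
  define y where "y = Im z"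
  have z: "z = \<i> * of_real y" using Re_eq_0_imp_imaginary[OF assms] by (simp add: y_def)
  \<comment> \<open>Normalised to have derivative \<open>exp (t\<^sup>2 / 2)\<close>; it vanishes at
    0 because \<open>Psi 0\<close> is real.\<close>
  define E where "E t = - (sqrt (2 * pi) * Im (Psi (\<i> * of_real t)))" for t
  have "(E has_real_derivative exp (t\<^sup>2 / 2)) (at t)" for t
  proof -
    have "(E has_real_derivative - (sqrt (2 * pi) * Im (- phi (\<i> * of_real t) * \<i>))) (at t)"
      unfolding E_def[abs_def] by (intro DERIV_minus DERIV_cmult has_real_derivative_Psi_line)
    then show ?thesis by (simp add: phi_imaginary)
  qed
  then have ineq: "exp (y\<^sup>2) / (y\<^sup>2 + 2 / pi) \<le> pi / 2 + (E y)\<^sup>2"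
    by (rule mills_real_inequality) (simp add: E_def Psi_0)
  have pos: "0 < y\<^sup>2 + 2 / pi" by (simp add: add_nonneg_pos)
  have "(norm (Psi z))\<^sup>2 = (1 / 2)\<^sup>2 + (E y)\<^sup>2 / (2 * pi)"
    unfolding z cmod_power2 Re_Psi_imaginary by (simp add: E_def power_mult_distrib)
  also have "\<dots> = (pi / 2 + (E y)\<^sup>2) / (2 * pi)"
    by (simp add: field_simps power2_eq_square)
  finally have "(norm (Psi z))\<^sup>2 * (2 * pi) = pi / 2 + (E y)\<^sup>2" by simp
  moreover have "(norm (phi z))\<^sup>2 = exp (y\<^sup>2) / (2 * pi)"
    unfolding z phi_imaginary norm_of_real by (simp add: power_divide exp_double[symmetric])
  ultimately have "(norm (mills z))\<^sup>2 = (pi / 2 + (E y)\<^sup>2) / exp (y\<^sup>2)"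
    by (simp add: mills_def norm_divide power_divide)
  moreover have "(norm (z + of_real (sqrt (2 / pi))))\<^sup>2 = y\<^sup>2 + 2 / pi"
    unfolding z cmod_power2 by simp
  moreover have "1 \<le> (y\<^sup>2 + 2 / pi) * ((pi / 2 + (E y)\<^sup>2) / exp (y\<^sup>2))"
    using ineq pos by (simp only: pos_divide_le_eq) (simp add: mult.commute pos_le_divide_eq)
  ultimately have "1\<^sup>2 \<le> (norm ((z + of_real (sqrt (2 / pi))) * mills z))\<^sup>2"
    by (simp add: norm_mult power_mult_distrib)
  then show ?thesis by (rule power2_le_imp_le) simp
qed

section \<open>Comparison of \<open>R\<close> with \<open>z + c\<close> and with
  \<open>z\<close>\<close>

lemma R_holomorphic: "R holomorphic_on {z. 0 \<le> Re z}"
  unfolding R_eq_inverse_mills[abs_def]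
  by (intro holomorphic_intros mills_holomorphic) (use mills_nonzero in auto)

lemma sqrt_two_over_pi: "0 < sqrt (2 / pi)" "sqrt (2 / pi) \<le> 1"
  using pi_ge_two by auto

text \<open>The quotient \<open>g\<close> of the two sides is the reciprocal of
  \<open>(w + c) * mills w\<close>, whose modulus is at least 1 on the imaginary axis and tends to 1
  at infinity.\<close>

lemma norm_R_le:
  assumes "0 \<le> Re z"
  shows "norm (R z) \<le> norm (z + of_real (sqrt (2 / pi)))"
proof -
  define c where "c = sqrt (2 / pi)"
  have c: "0 < c" "c \<le> 1" using sqrt_two_over_pi by (auto simp: c_def)
  have nz: "w + of_real c \<noteq> 0" if "0 \<le> Re w" for w
    using that c by (auto simp: complex_eq_iff)
  define g where "g w = R w / (w + of_real c)" for w
  have g: "norm (g w) = 1 / norm ((w + of_real c) * mills w)" for w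
    by (simp add: g_def R_eq_inverse_mills norm_divide norm_mult mult.commute)
  have holo: "g holomorphic_on {z. 0 \<le> Re z}"
    unfolding g_def[abs_def] by (intro holomorphic_intros R_holomorphic) (use nz in auto)
  have "norm (g z) \<le> 1"
  proof (rule norm_le_1_right_halfplane[OF _ _ _ _ assms])
    show "g holomorphic_on {z. 0 < Re z}"
      by (rule holomorphic_on_subset[OF holo]) auto
    show "continuous_on {z. 0 \<le> Re z} g"
      by (rule holomorphic_on_imp_continuous_on[OF holo])
    show "norm (g w) \<le> 1" if "Re w = 0" for w
      using norm_mills_imaginary[OF that] unfolding g c_def by (intro divide_le_eq_1[THEN iffD2]) auto
    fix e :: real
    assume e: "0 < e"
    show "\<exists>r. \<forall>w. 0 \<le> Re w \<longrightarrow> r \<le> norm w \<longrightarrow> norm (g w) \<le> 1 + e"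
    proof (intro exI allI impI)
      fix w
      \<comment> \<open>As \<open>c \<le> 1\<close>, \<open>(w + c) * mills w\<close> differs from 1
        by at most \<open>(2 + 3) / norm w\<close>. The threshold brings this below
        \<open>e / (1 + e)\<close>, which makes the reciprocal at most \<open>1 + e\<close>.\<close>
      assume w: "0 \<le> Re w" "max 1 (5 * (1 + e) / e) \<le> norm w"
      have w1: "1 \<le> norm w" "w \<noteq> 0" using w(2) by auto
      have "norm ((w * mills w - 1) + of_real c * mills w) \<le> 2 / norm w + 1 * (3 / norm w)"
        using mills_asymptotic[OF w(1) w1(2)] norm_mills_le[OF w(1) w1(1)] c
        by (intro norm_triangle_mono) (simp, unfold norm_mult, intro mult_mono, simp_all)
      also have "\<dots> = 5 / norm w" by (simp add: add_divide_distrib[symmetric])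
      also have "\<dots> \<le> e / (1 + e)"
      proof -
        have "5 * (1 + e) \<le> e * norm w" using w(2) e by (simp add: field_simps)
        then show ?thesis using w1 e by (intro frac_le_eq[THEN iffD2]) (auto simp: field_simps)
      qed
      finally have "norm (1 - (w + of_real c) * mills w) \<le> e / (1 + e)"
        by (simp add: norm_minus_commute algebra_simps)
      then have "1 - e / (1 + e) \<le> norm ((w + of_real c) * mills w)"
        using norm_triangle_ineq2[of 1 "1 - (w + of_real c) * mills w"] by simp
      also have "1 - e / (1 + e) = 1 / (1 + e)" using e by (simp add: field_simps)
      finally have "1 / norm ((w + of_real c) * mills w) \<le> 1 / (1 / (1 + e))"
        using e nz[OF w(1)] mills_nonzero[OF w(1)] by (intro divide_left_mono) auto
      then show "norm (g w) \<le> 1 + e" by (simp add: g)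
    qed
  qed
  then show ?thesis
    using nz[OF assms] by (simp add: g_def norm_divide c_def)
qed

text \<open>In \<open>R z - z = z * (1 - z * mills z) / (z * mills z)\<close> the numerator has
  modulus at most 2, and \<open>4 \<le> norm z\<close> keeps the denominator at least 1/2.\<close>

lemma norm_R_minus_ident_le:
  assumes "0 \<le> Re z" "4 \<le> norm z"
  shows "norm (R z - z) \<le> 4"
proof -
  have z: "z \<noteq> 0" using assms(2) by auto
  have a: "norm (z * mills z - 1) \<le> 2 / norm z"
    using mills_asymptotic[OF assms(1) z] .
  also have "\<dots> \<le> 1 / 2" using assms(2) z by (simp add: pos_divide_le_eq)
  finally have b: "1 / 2 \<le> norm (z * mills z)"
    using norm_triangle_ineq2[of 1 "1 - z * mills z"] by (simp add: norm_minus_commute)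
  have "R z - z = z * (1 - z * mills z) / (z * mills z)"
    using z mills_nonzero[OF assms(1)] by (simp add: R_eq_inverse_mills field_simps)
  also have "norm \<dots> = norm z * norm (z * mills z - 1) / norm (z * mills z)"
    by (simp add: norm_divide norm_mult norm_minus_commute)
  also have "\<dots> \<le> norm z * (2 / norm z) / (1 / 2)"
    using a b by (intro frac_le mult_left_mono) auto
  also have "\<dots> = 4" using z by simp
  finally show ?thesis .
qed

section \<open>Derivatives of the inverse Mills ratio\<close>

text \<open>For \<open>r < Re z\<close> the circle of radius \<open>r\<close> stays in the
  half-plane where \<open>norm_R_le\<close> holds. The resulting bound is continuous in
  \<open>r\<close> and passes to the limit at \<open>Re z\<close>.\<close>

lemma norm_higher_deriv_R_le:
  assumes "0 < Re z"
  shows "norm ((deriv ^^ n) R z)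
    \<le> fact n / Re z ^ n * sqrt ((norm (z + of_real (sqrt (2 / pi))))\<^sup>2 + (Re z)\<^sup>2)"
proof (rule tendsto_lowerbound)
  have "cball z r \<subseteq> {z. 0 \<le> Re z}" if "r < Re z" for r
  proof
    fix w assume "w \<in> cball z r"
    then have "\<bar>Re (z - w)\<bar> \<le> r"
      using abs_Re_le_cmod[of "z - w"] by (simp add: dist_norm)
    then show "w \<in> {z. 0 \<le> Re z}" using that by simp
  qed
  then have le: "norm ((deriv ^^ n) R z)
      \<le> fact n / r ^ n * sqrt ((norm (z + of_real (sqrt (2 / pi))))\<^sup>2 + r\<^sup>2)"
    if "0 < r" "r < Re z" for r
    using that
    by (intro norm_higher_deriv_le_affine norm_R_le holomorphic_on_imp_continuous_on
        holomorphic_on_subset[OF R_holomorphic] subset_trans[OF ball_subset_cball])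
      (auto simp: subset_iff dist_norm norm_minus_commute)
  show "\<forall>\<^sub>F r in at_left (Re z). norm ((deriv ^^ n) R z)
      \<le> fact n / r ^ n * sqrt ((norm (z + of_real (sqrt (2 / pi))))\<^sup>2 + r\<^sup>2)"
    using eventually_at_left_real[OF assms] by eventually_elim (use le in auto)
  show "((\<lambda>r. fact n / r ^ n * sqrt ((norm (z + of_real (sqrt (2 / pi))))\<^sup>2 + r\<^sup>2))
      \<longlongrightarrow> fact n / Re z ^ n * sqrt ((norm (z + of_real (sqrt (2 / pi))))\<^sup>2 + (Re z)\<^sup>2)) (at_left (Re z))"
    using assms by (intro tendsto_intros) auto
qed simp

text \<open>The subtracted indicator is the derivative of order \<open>n\<close> of the identity, so
  Cauchy's inequality applies to the bounded function \<open>R w - w\<close>.\<close>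

lemma norm_higher_deriv_R_minus_ident_le:
  assumes "8 \<le> Re z" "1 \<le> n"
  shows "norm ((deriv ^^ n) R z - (if n = 1 then 1 else 0)) \<le> fact n * 4 * 2 ^ n / Re z ^ n"
proof -
  \<comment> \<open>Half of \<open>Re z\<close> leaves \<open>r \<le> Re w\<close> on the disc; with
    \<open>8 \<le> Re z\<close> this gives \<open>4 \<le> norm w\<close>, as
    \<open>norm_R_minus_ident_le\<close> requires.\<close>
  define r where "r = Re z / 2"
  have r: "4 \<le> r" "0 < r" using assms by (auto simp: r_def)
  have Re: "r \<le> Re w" if "w \<in> cball z r" for w
    using that abs_Re_le_cmod[of "z - w"] by (simp add: dist_norm r_def)
  have sub: "cball z r \<subseteq> {z. 0 \<le> Re z}"
    using Re r by fastforce
  have holo: "R holomorphic_on cball z r"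
    by (rule holomorphic_on_subset[OF R_holomorphic sub])
  then have holo_ball: "R holomorphic_on ball z r"
    by (rule holomorphic_on_subset) auto
  have "norm ((deriv ^^ n) (\<lambda>w. R w - w) z) \<le> fact n * 4 / r ^ n"
  proof (rule Cauchy_inequality)
    show "(\<lambda>w. R w - w) holomorphic_on ball z r"
      by (intro holomorphic_intros holo_ball)
    show "continuous_on (cball z r) (\<lambda>w. R w - w)"
      by (intro continuous_intros holomorphic_on_imp_continuous_on holo)
    fix w assume "norm (z - w) = r"
    then have "r \<le> Re w" by (intro Re) (simp add: dist_norm)
    then show "norm (R w - w) \<le> 4"
      using r abs_Re_le_cmod[of w] by (intro norm_R_minus_ident_le) linarith+
  qed (rule r)
  moreover have "(deriv ^^ n) (\<lambda>w. R w - w) z = (deriv ^^ n) R z - (deriv ^^ n) (\<lambda>w. w) z"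
    by (rule higher_deriv_diff[OF holo_ball]) (use r in \<open>auto intro: holomorphic_intros\<close>)
  ultimately show ?thesis
    using assms(2) by (simp add: r_def power_divide)
qed

theorem corollary1p6:
  fixes n :: nat
  assumes "n \<ge> 1"
  shows "(\<forall>z\<in>Hplus. Re z > 0 \<longrightarrow>
            norm ((deriv ^^ n) R z)
              \<le> fact n / Re z ^ n * sqrt ((norm (z + of_real (sqrt (2 / pi))))\<^sup>2 + (Re z)\<^sup>2))
       \<and> (\<forall>\<epsilon>>0. \<exists>x\<^sub>0. \<forall>z\<in>Hplus. Re z \<ge> x\<^sub>0 \<longrightarrow>
            norm ((deriv ^^ n) R z - (if n = 1 then 1 else 0)) / (norm z / Re z ^ n) < \<epsilon>)"
proof (intro conjI ballI impI allI)
  show "norm ((deriv ^^ n) R z)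
      \<le> fact n / Re z ^ n * sqrt ((norm (z + of_real (sqrt (2 / pi))))\<^sup>2 + (Re z)\<^sup>2)"
    if "0 < Re z" for z
    using that by (rule norm_higher_deriv_R_le)
  fix \<epsilon> :: real
  assume eps: "0 < \<epsilon>"
  define C :: real where "C = fact n * 4 * 2 ^ n"
  have C: "0 < C" by (simp add: C_def)
  show "\<exists>x\<^sub>0. \<forall>z\<in>Hplus. Re z \<ge> x\<^sub>0 \<longrightarrow>
      norm ((deriv ^^ n) R z - (if n = 1 then 1 else 0)) / (norm z / Re z ^ n) < \<epsilon>"
  proof (intro exI ballI impI)
    fix z
    \<comment> \<open>The powers of \<open>Re z\<close> cancel and leave \<open>C / norm z\<close>.
      Since \<open>Re z \<le> norm z\<close>, a threshold on \<open>Re z\<close> alone suffices,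
      which gives uniformity in \<open>Im z\<close>.\<close>
    assume z: "max 8 (C / \<epsilon> + 1) \<le> Re z"
    then have pos: "0 < Re z" "0 < norm z" using abs_Re_le_cmod[of z] by auto
    have "norm ((deriv ^^ n) R z - (if n = 1 then 1 else 0)) / (norm z / Re z ^ n)
        \<le> (C / Re z ^ n) / (norm z / Re z ^ n)"
      unfolding C_def using z assms pos
      by (intro divide_right_mono norm_higher_deriv_R_minus_ident_le) auto
    also have "\<dots> = C / norm z" using pos by simp
    also have "\<dots> < \<epsilon>"
    proof -
      have "C / \<epsilon> < norm z" using z abs_Re_le_cmod[of z] by linarith
      then show ?thesis using eps pos by (simp add: field_simps)
    qed
    finally show "norm ((deriv ^^ n) R z - (if n = 1 then 1 else 0)) / (norm z / Re z ^ n) < \<epsilon>" .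
  qed
qed

end
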